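(* Let $H$ be a Hilbert left $\mathbb{O}$-module and let $S=\{x_\alpha\}_{\alpha\in\Lambda}$ be an orthonormal basis of $H$. Then $S$ is a Hilbert basis if and only if $S$ is weak associative.
   Context: $\mathbb{O}$ is the real algebra of octonions, with conjugation $x\mapsto\overline{x}$ and real part $\operatorname{Re}x=\tfrac12(x+\overline{x})$. A left $\mathbb{O}$-module is a real vector space $M$ with an $\mathbb{R}$-linear map $L:\mathbb{O}\to\operatorname{End}_{\mathbb{R}}(M)$, written $px:=L_p(x)$, such that $1x=x$ and $[p,q,x]=-[q,p,x]$ for all $p,q\in\mathbb{O}$, $x\in M$, where $[p,q,x]:=(pq)x-p(qx)$ (equivalently $p(px)=p^2x$ for all $p,x$). A Hilbert left $\mathbb{O}$-module (or $\mathbb{O}$-Hilbert space) is a left $\mathbb{O}$-module $H$ with an $\mathbb{R}$-bilinear map $\langle\cdot,\cdot\rangle:H\times H\to\mathbb{O}$ such that for all $u,v\in H$, $p\in\mathbb{O}$: (1) $\operatorname{Re}(\langle pu,v\rangle-p\langle u,v\rangle)=0$; (2) $\langle u,v\rangle=\overline{\langle v,u\rangle}$; (3) $\langle u,u\rangle\in[0,\infty)$, and $\langle u,u\rangle=0$ iff $u=0$; and $H$ is complete for the norm $\|u\|=\sqrt{\langle u,u\rangle}$. The second associator is $[p,u,v]:=\langle pu,v\rangle-p\langle u,v\rangle$ for $p\in\mathbb{O}$, $u,v\in H$. A subset $S=\{x_\alpha\}_{\alpha\in\Lambda}\subseteq H$ is an orthonormal system if $\langle x_\alpha,x_\beta\rangle=\delta_{\alpha\beta}$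 for all $\alpha,\beta\in\Lambda$; it is an orthonormal basis if it is an orthonormal system not properly contained in any other orthonormal system. An orthonormal basis $S$ is weak associative if $[p,x_\alpha,x_\beta]=0$ for all $p\in\mathbb{O}$ and all $\alpha,\beta\in\Lambda$. An orthonormal basis $S$ is a Hilbert basis if $\|x\|^2=\sum_{\alpha\in\Lambda}|\langle x,x_\alpha\rangle|^2$ for every $x\in H$. *)

theory Defs
  imports "HOL-Analysis.Analysis"
begin

section \<open>Octonions\<close>

datatype octonion = Octonion
  (O0: real) (O1: real) (O2: real) (O3: real) (O4: real) (O5: real) (O6: real) (O7: real)

lemma octonion_eq_iff:
  "p = q \<longleftrightarrow> O0 p = O0 q \<and> O1 p = O1 q \<and> O2 p = O2 q \<and> O3 p = O3 q \<and>
    O4 p = O4 q \<and> O5 p = O5 q \<and> O6 p = O6 q \<and> O7 p = O7 q"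
  by (cases p; cases q) simp

text \<open>
  In terms of the coordinates \<open>O0, \<dots>, O7\<close> with respect to the basis \<open>1, e1, \<dots>, e7\<close>, the product
  below is the bilinear one with unit \<open>1\<close>, \<open>ei ei = -1\<close>, and
  \<open>ei ej = ek = - ej ei\<close> for \<open>(i,j,k)\<close> any cyclic permutation of one of
  \<open>(1,2,3), (1,4,5), (1,7,6), (2,4,6), (2,5,7), (3,4,7), (3,6,5)\<close>.
  The product is not associative, so \<open>octonion\<close> cannot be an instance of \<open>real_algebra\<close>;
  only \<open>real_inner\<close>, \<open>times\<close> and \<open>one\<close> are instantiated.  The norm is the Euclidean one,
  that is, the usual modulus of octonions.
\<close>

instantiation octonion :: real_vector
begin

definition "0 = Octonion 0 0 0 0 0 0 0 0"

definition "p + q = Octonion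
    (O0 p + O0 q) (O1 p + O1 q) (O2 p + O2 q) (O3 p + O3 q)
    (O4 p + O4 q) (O5 p + O5 q) (O6 p + O6 q) (O7 p + O7 q)"

definition "p - q = Octonion
    (O0 p - O0 q) (O1 p - O1 q) (O2 p - O2 q) (O3 p - O3 q)
    (O4 p - O4 q) (O5 p - O5 q) (O6 p - O6 q) (O7 p - O7 q)"

definition "- p = Octonion
    (- O0 p) (- O1 p) (- O2 p) (- O3 p)
    (- O4 p) (- O5 p) (- O6 p) (- O7 p)"

definition "r *\<^sub>R p = Octonion
    (r * O0 p) (r * O1 p) (r * O2 p) (r * O3 p)
    (r * O4 p) (r * O5 p) (r * O6 p) (r * O7 p)"

instance
  by standard (simp_all add: octonion_eq_iff zero_octonion_def plus_octonion_def
    minus_octonion_def uminus_octonion_def scaleR_octonion_def algebra_simps)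

end

instantiation octonion :: real_inner
begin

definition "inner p q =
    O0 p * O0 q + O1 p * O1 q + O2 p * O2 q + O3 p * O3 q +
      O4 p * O4 q + O5 p * O5 q + O6 p * O6 q + O7 p * O7 q"

definition "norm (p :: octonion) = sqrt (inner p p)"

definition "sgn (p :: octonion) = p /\<^sub>R norm p"

definition "dist p q = norm (p - q :: octonion)"

definition [code del]:
  "(uniformity :: (octonion \<times> octonion) filter) =
    (INF e\<in>{0 <..}. principal {(x, y). dist x y < e})"

definition [code del]:
  "open (U :: octonion set) \<longleftrightarrow>
    (\<forall>x\<in>U. eventually (\<lambda>(x', y). x' = x \<longrightarrow> y \<in> U) uniformity)"

instance
proof
  fix p q r :: octonion and a b :: real and U :: "octonion set"
  note defs = octonion_eq_iff zero_octonion_def plus_octonion_def scaleR_octonion_def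
    inner_octonion_def
  show "dist p q = norm (p - q)" "sgn p = p /\<^sub>R norm p" "norm p = sqrt (inner p p)"
    by (rule dist_octonion_def sgn_octonion_def norm_octonion_def)+
  show "(uniformity :: (octonion \<times> octonion) filter) =
      (INF e\<in>{0 <..}. principal {(x, y). dist x y < e})"
    by (rule uniformity_octonion_def)
  show "open U \<longleftrightarrow> (\<forall>x\<in>U. eventually (\<lambda>(x', y). x' = x \<longrightarrow> y \<in> U) uniformity)"
    by (rule open_octonion_def)
  show "inner p q = inner q p" "inner (p + q) r = inner p r + inner q r"
    "inner (a *\<^sub>R p) q = a * inner p q" "0 \<le> inner p p"
    by (simp_all add: defs algebra_simps)
  show "inner p p = 0 \<longleftrightarrow> p = 0"
    by (simp add: defs add_nonneg_eq_0_iff)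
qed

end

instantiation octonion :: "{one, times}"
begin

definition "1 = Octonion 1 0 0 0 0 0 0 0"

definition "p * q = Octonion
    (O0 p * O0 q - O1 p * O1 q - O2 p * O2 q - O3 p * O3 q
     - O4 p * O4 q - O5 p * O5 q - O6 p * O6 q - O7 p * O7 q)
    (O0 p * O1 q + O1 p * O0 q + O2 p * O3 q - O3 p * O2 q
     + O4 p * O5 q - O5 p * O4 q - O6 p * O7 q + O7 p * O6 q)
    (O0 p * O2 q - O1 p * O3 q + O2 p * O0 q + O3 p * O1 q
     + O4 p * O6 q + O5 p * O7 q - O6 p * O4 q - O7 p * O5 q)
    (O0 p * O3 q + O1 p * O2 q - O2 p * O1 q + O3 p * O0 q
     + O4 p * O7 q - O5 p * O6 q + O6 p * O5 q - O7 p * O4 q)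
    (O0 p * O4 q - O1 p * O5 q - O2 p * O6 q - O3 p * O7 q
     + O4 p * O0 q + O5 p * O1 q + O6 p * O2 q + O7 p * O3 q)
    (O0 p * O5 q + O1 p * O4 q - O2 p * O7 q + O3 p * O6 q
     - O4 p * O1 q + O5 p * O0 q - O6 p * O3 q + O7 p * O2 q)
    (O0 p * O6 q + O1 p * O7 q + O2 p * O4 q - O3 p * O5 q
     - O4 p * O2 q + O5 p * O3 q + O6 p * O0 q - O7 p * O1 q)
    (O0 p * O7 q - O1 p * O6 q + O2 p * O5 q + O3 p * O4 q
     - O4 p * O3 q - O5 p * O2 q + O6 p * O1 q + O7 p * O0 q)"

instance ..

end

definition oct_cnj :: "octonion \<Rightarrow> octonion" where
  "oct_cnj p = Octonion (O0 p) (- O1 p) (- O2 p) (- O3 p) (- O4 p) (- O5 p) (- O6 p) (- O7 p)"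

text \<open>The real part is real-valued; reals are embedded into the octonions as multiples of \<open>1\<close>.\<close>

definition oct_Re :: "octonion \<Rightarrow> real" where
  "oct_Re p = O0 p"

lemmas octonion_defs = octonion_eq_iff zero_octonion_def plus_octonion_def minus_octonion_def
  uminus_octonion_def scaleR_octonion_def one_octonion_def times_octonion_def
  oct_cnj_def oct_Re_def

lemma oct_Re_conv_cnj: "oct_Re p *\<^sub>R 1 = (1/2) *\<^sub>R (p + oct_cnj p)"
  by (simp add: octonion_defs)

lemma octonion_mult_1: "1 * p = p" "p * 1 = p" for p :: octonion
  by (simp_all add: octonion_defs)

lemma bilinear_octonion_mult: "bilinear ((*) :: octonion \<Rightarrow> octonion \<Rightarrow> octonion)"
  by (auto simp: bilinear_def octonion_defs algebra_simps intro!: linearI)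

lemma octonion_alternative:
  fixes p q :: octonion
  shows "p * (p * q) = (p * p) * q" "(q * p) * p = q * (p * p)"
  by (simp_all add: octonion_defs algebra_simps)

lemma octonion_mult_cnj: "p * oct_cnj p = (norm p)\<^sup>2 *\<^sub>R 1"
  by (simp add: octonion_defs power2_norm_eq_inner inner_octonion_def algebra_simps)

lemma norm_octonion_mult: "norm (p * q) = norm p * norm q" for p q :: octonion
proof -
  have "(norm (p * q))\<^sup>2 = (norm p * norm q)\<^sup>2"
    unfolding power_mult_distrib power2_norm_eq_inner
    by (simp add: octonion_defs inner_octonion_def algebra_simps)
  thus ?thesis
    by (simp add: power2_eq_iff_nonneg)
qed


section \<open>Hilbert left octonion modules\<close>

text \<open>
  The underlying real vector space is a type \<open>'h\<close>, and \<open>L p x\<close> is the product of the scalar \<open>p\<close>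
  with the vector \<open>x\<close>.
\<close>

definition associator :: "(octonion \<Rightarrow> 'h \<Rightarrow> 'h::real_vector) \<Rightarrow> octonion \<Rightarrow> octonion \<Rightarrow> 'h \<Rightarrow> 'h" where
  "associator L p q x = L (p * q) x - L p (L q x)"

text \<open>Bilinearity of \<open>L\<close> says that \<open>L\<close> is a real-linear map from the octonions to the real-linear
  endomorphisms of \<open>'h\<close>.\<close>

locale left_octonion_module =
  fixes L :: "octonion \<Rightarrow> 'h \<Rightarrow> 'h::real_vector"
  assumes bilinear_L: "bilinear L"
    and L_1: "L 1 x = x"
    and associator_swap: "associator L p q x = - associator L q p x"

definition second_associator ::
    "(octonion \<Rightarrow> 'h \<Rightarrow> 'h::real_vector) \<Rightarrow> ('h \<Rightarrow> 'h \<Rightarrow> octonion) \<Rightarrow> octonion \<Rightarrow> 'h \<Rightarrow> 'h \<Rightarrow> octonion" where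
  "second_associator L ip p u v = ip (L p u) v - p * ip u v"

text \<open>\<open>ip u u\<close> is a nonnegative multiple of \<open>1\<close>, so \<open>oct_Re\<close> merely converts it to a real number.\<close>

definition hnorm :: "('h \<Rightarrow> 'h \<Rightarrow> octonion) \<Rightarrow> 'h \<Rightarrow> real" where
  "hnorm ip u = sqrt (oct_Re (ip u u))"

locale hilbert_left_octonion_module = left_octonion_module L
  for L :: "octonion \<Rightarrow> 'h \<Rightarrow> 'h::real_vector" +
  fixes ip :: "'h \<Rightarrow> 'h \<Rightarrow> octonion"
  assumes bilinear_ip: "bilinear ip"
    and Re_second_associator: "oct_Re (second_associator L ip p u v) = 0"
    and ip_cnj: "ip u v = oct_cnj (ip v u)"
    and ip_nonneg: "\<exists>r\<ge>0. ip u u = r *\<^sub>R 1"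
    and ip_eq_0_iff: "ip u u = 0 \<longleftrightarrow> u = 0"
    and complete:
      "(\<forall>e>0. \<exists>N. \<forall>m\<ge>N. \<forall>n\<ge>N. hnorm ip (X m - X n) < e) \<Longrightarrow>
        \<exists>l. (\<lambda>n. hnorm ip (X n - l)) \<longlonglongrightarrow> 0"

text \<open>
  The vectors of an orthonormal system are pairwise distinct, so systems are represented by their
  sets of members, each member serving as its own index.
\<close>

definition orthonormal_system :: "('h \<Rightarrow> 'h \<Rightarrow> octonion) \<Rightarrow> 'h set \<Rightarrow> bool" where
  "orthonormal_system ip S \<longleftrightarrow> (\<forall>x\<in>S. \<forall>y\<in>S. ip x y = (if x = y then 1 else 0))"

definition orthonormal_basis :: "('h \<Rightarrow> 'h \<Rightarrow> octonion) \<Rightarrow> 'h set \<Rightarrow> bool" where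
  "orthonormal_basis ip S \<longleftrightarrow>
    orthonormal_system ip S \<and> (\<nexists>T. orthonormal_system ip T \<and> S \<subset> T)"

definition weak_associative ::
    "(octonion \<Rightarrow> 'h \<Rightarrow> 'h::real_vector) \<Rightarrow> ('h \<Rightarrow> 'h \<Rightarrow> octonion) \<Rightarrow> 'h set \<Rightarrow> bool" where
  "weak_associative L ip S \<longleftrightarrow>
    orthonormal_basis ip S \<and> (\<forall>p. \<forall>x\<in>S. \<forall>y\<in>S. second_associator L ip p x y = 0)"

definition hilbert_basis :: "('h \<Rightarrow> 'h \<Rightarrow> octonion) \<Rightarrow> 'h set \<Rightarrow> bool" where
  "hilbert_basis ip S \<longleftrightarrow>
    orthonormal_basis ip S \<and>
    (\<forall>x. ((\<lambda>s. (norm (ip x s))\<^sup>2) has_sum (hnorm ip x)\<^sup>2) S)"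

end

theory Submission
  imports Defs
begin

text \<open>
  For a unit vector \<open>s\<close> one always has \<open>\<langle>p s, s\<rangle> = p\<close> and \<open>\<parallel>p s\<parallel> = |p|\<close>. Hence Parseval's identity
  for \<open>p s\<close> leaves no room for the other basis vectors, so \<open>\<langle>p s, t\<rangle> = 0 = p \<langle>s, t\<rangle>\<close> for \<open>t \<noteq> s\<close>.
  Conversely, weak associativity makes the subspaces \<open>\<O> s\<close> orthogonal, so that the partial sums
  of \<open>\<Sum>\<langle>x, s\<rangle> s\<close> converge to some \<open>l\<close> with \<open>x - l\<close> orthogonal to the whole system; maximality of
  the system forces \<open>x = l\<close>, which is Parseval's identity.
\<close>

section \<open>Octonion identities\<close>

lemma oct_Re_simps [simp]:
  "oct_Re (p + q) = oct_Re p + oct_Re q" "oct_Re (p - q) = oct_Re p - oct_Re q"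
  "oct_Re (- p) = - oct_Re p" "oct_Re (r *\<^sub>R p) = r * oct_Re p"
  "oct_Re 0 = 0" "oct_Re 1 = 1" "oct_Re (oct_cnj p) = oct_Re p"
  by (simp_all add: octonion_defs)

lemma oct_cnj_simps [simp]: "oct_cnj (oct_cnj p) = p" "oct_cnj 0 = 0"
  by (simp_all add: octonion_defs)

lemma oct_Re_mult: "oct_Re (p * q) = inner p (oct_cnj q)"
  by (simp add: octonion_defs inner_octonion_def)

text \<open>Places the conjugate in the real span of \<open>1\<close> and \<open>p\<close>, so that
  facts about \<open>L p\<close> and \<open>L 1\<close> carry over to
  \<open>L (oct_cnj p)\<close>.\<close>

lemma oct_cnj_conv_Re: "oct_cnj p = (2 * oct_Re p) *\<^sub>R 1 - p"
  by (simp add: octonion_defs)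

lemma octonion_cnj_mult: "oct_cnj p * p = (norm p)\<^sup>2 *\<^sub>R 1"
  by (simp add: octonion_defs power2_norm_eq_inner inner_octonion_def algebra_simps)

lemma inner_mult_cnj: "inner p (oct_cnj q) = inner q (oct_cnj p)"
  by (simp add: octonion_defs inner_octonion_def)

lemmas oct_mult_bilinear [simp] =
  bilinear_ladd [OF bilinear_octonion_mult] bilinear_lmul [OF bilinear_octonion_mult]
  bilinear_lsub [OF bilinear_octonion_mult] bilinear_rzero [OF bilinear_octonion_mult]

section \<open>Alternativity of the module action\<close>

context left_octonion_module
begin

lemmas L_bilinear =
  bilinear_ladd [OF bilinear_L] bilinear_lmul [OF bilinear_L] bilinear_lsub [OF bilinear_L]
  bilinear_radd [OF bilinear_L] bilinear_rmul [OF bilinear_L] bilinear_rsub [OF bilinear_L]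

lemma associator_self: "associator L p p x = 0"
proof -
  have "2 *\<^sub>R associator L p p x = associator L p p x + - associator L p p x"
    using associator_swap [of p p x] by (simp add: scaleR_2)
  thus ?thesis by simp
qed

text \<open>The associator vanishes on \<open>p, p\<close>, hence also on
  \<open>oct_cnj p, p\<close>, because \<open>oct_cnj p\<close> is a real combination of
  \<open>1\<close> and \<open>p\<close>.\<close>

lemma L_cnj_L: "L (oct_cnj p) (L p x) = (norm p)\<^sup>2 *\<^sub>R x"
proof -
  have "L (p * p) x = L p (L p x)"
    using associator_self [of p x] by (simp add: associator_def)
  hence "L (oct_cnj p) (L p x) = L (oct_cnj p * p) x"
    by (simp add: oct_cnj_conv_Re L_bilinear L_1 octonion_mult_1)
  thus ?thesis
    by (simp add: octonion_cnj_mult L_bilinear L_1)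
qed

end

section \<open>The real inner product and unit vectors\<close>

context hilbert_left_octonion_module
begin

lemmas ip_bilinear =
  bilinear_ladd [OF bilinear_ip] bilinear_lmul [OF bilinear_ip] bilinear_lsub [OF bilinear_ip]
  bilinear_radd [OF bilinear_ip] bilinear_rmul [OF bilinear_ip] bilinear_rsub [OF bilinear_ip]

lemma linear_ip_left: "linear (\<lambda>u. ip u v)"
  using bilinear_ip by (simp add: bilinear_def)

lemma Re_ip_commute: "oct_Re (ip u v) = oct_Re (ip v u)"
  using ip_cnj [of u v] by simp

lemma ip_self: "ip u u = (hnorm ip u)\<^sup>2 *\<^sub>R 1"
proof -
  obtain r where "r \<ge> 0" "ip u u = r *\<^sub>R 1" using ip_nonneg by blast
  thus ?thesis by (simp add: hnorm_def)
qed

lemma hnorm_sq: "(hnorm ip u)\<^sup>2 = oct_Re (ip u u)"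
  by (simp add: ip_self [of u])

lemma hnorm_nonneg: "hnorm ip u \<ge> 0"
proof -
  obtain r where "r \<ge> 0" "ip u u = r *\<^sub>R 1" using ip_nonneg by blast
  thus ?thesis by (simp add: hnorm_def)
qed

lemma hnorm_diff_sq:
  "(hnorm ip (u - v))\<^sup>2 = (hnorm ip u)\<^sup>2 - 2 * oct_Re (ip v u) + (hnorm ip v)\<^sup>2"
  by (simp add: hnorm_sq ip_bilinear Re_ip_commute [of u v])

text \<open>The second associator has no real part, and the real part of \<open>p * q\<close> is
  \<open>inner p (oct_cnj q)\<close>; the conjugate swaps the arguments of
  \<open>ip\<close>.\<close>

lemma Re_ip_L: "oct_Re (ip (L p u) v) = inner p (ip v u)"
  using Re_second_associator [of p u v] ip_cnj [of v u]
  by (simp add: second_associator_def oct_Re_mult)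

text \<open>For the real inner product given by the real part of \<open>ip\<close>, the adjoint of
  \<open>L p\<close> is \<open>L (oct_cnj p)\<close>, and \<open>L_cnj_L\<close> evaluates their
  composition.\<close>

lemma hnorm_L_sq: "(hnorm ip (L p u))\<^sup>2 = (norm p)\<^sup>2 * (hnorm ip u)\<^sup>2"
proof -
  have "(norm p)\<^sup>2 * (hnorm ip u)\<^sup>2 = oct_Re (ip (L (oct_cnj p) (L p u)) u)"
    by (simp add: L_cnj_L ip_bilinear hnorm_sq)
  also have "\<dots> = inner (oct_cnj p) (ip u (L p u))"
    by (rule Re_ip_L)
  also have "\<dots> = inner p (ip (L p u) u)"
    by (metis ip_cnj inner_mult_cnj inner_commute)
  finally show ?thesis
    by (simp add: hnorm_sq Re_ip_L)
qed

text \<open>The vector \<open>L a s\<close> with \<open>a = ip v s\<close> is the real orthogonal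
  projection of \<open>v\<close> onto the octonion multiples of \<open>s\<close>; its residual has
  nonnegative squared norm.\<close>

lemma ip_unit_bound:
  assumes "ip s s = 1"
  shows "norm (ip v s) \<le> hnorm ip v"
proof -
  define a where "a = ip v s"
  have "0 \<le> (hnorm ip (v - L a s))\<^sup>2" by simp
  also have "\<dots> = (hnorm ip v)\<^sup>2 - (norm a)\<^sup>2"
    using assms
    by (simp add: hnorm_diff_sq hnorm_L_sq Re_ip_L hnorm_sq [of s] power2_norm_eq_inner
        flip: a_def)
  finally have "(norm a)\<^sup>2 \<le> (hnorm ip v)\<^sup>2" by simp
  thus ?thesis
    unfolding a_def by (rule power2_le_imp_le) (rule hnorm_nonneg)
qed

text \<open>This is the equality case of Cauchy-Schwarz: \<open>?a\<close> has norm at most that of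
  \<open>p\<close>, yet its inner product with \<open>p\<close> is the full
  \<open>(norm p)\<^sup>2\<close>.\<close>

lemma ip_L_unit:
  assumes "ip s s = 1"
  shows "ip (L p s) s = p"
proof -
  let ?a = "ip (L p s) s"
  have h: "(hnorm ip (L p s))\<^sup>2 = (norm p)\<^sup>2"
    using assms by (simp add: hnorm_L_sq hnorm_sq [of s])
  have "(norm ?a)\<^sup>2 \<le> (norm p)\<^sup>2"
    using ip_unit_bound [OF assms, of "L p s"] by (metis h norm_ge_zero power_mono)
  moreover have "inner p ?a = (norm p)\<^sup>2"
    by (metis Re_ip_L h hnorm_sq)
  ultimately have "(norm (?a - p))\<^sup>2 \<le> 0"
    by (simp add: power2_norm_eq_inner inner_diff_left inner_diff_right inner_commute)
  thus ?thesis by simp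
qed

section \<open>From Parseval's identity to weak associativity\<close>

lemma hilbert_basis_imp_weak_associative:
  assumes "hilbert_basis ip S"
  shows "weak_associative L ip S"
proof -
  have orth: "ip x y = (if x = y then 1 else 0)" if "x \<in> S" "y \<in> S" for x y
    using assms that by (simp add: hilbert_basis_def orthonormal_basis_def orthonormal_system_def)
  have "second_associator L ip p x y = 0" if x: "x \<in> S" and y: "y \<in> S" for p x y
  proof (cases "x = y")
    case True
    with orth [OF x y] show ?thesis
      by (simp add: second_associator_def ip_L_unit octonion_mult_1)
  next
    case False
    let ?f = "\<lambda>s. (norm (ip (L p x) s))\<^sup>2"
    have sum: "(?f has_sum (hnorm ip (L p x))\<^sup>2) S"
      using assms by (simp add: hilbert_basis_def)
    \<comment> \<open>The term at \<open>x\<close> alone already equals the right-hand side, so the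
      term at \<open>y\<close> must vanish.\<close>
    have "sum ?f {x, y} \<le> (hnorm ip (L p x))\<^sup>2"
      by (rule has_sum_mono_neutral [OF has_sum_finite sum]) (use x y in auto)
    hence "ip (L p x) y = 0"
      using False orth [OF x x] by (simp add: ip_L_unit hnorm_L_sq hnorm_sq [of x])
    with False orth [OF x y] show ?thesis
      by (simp add: second_associator_def)
  qed
  with assms show ?thesis
    by (simp add: weak_associative_def hilbert_basis_def)
qed

section \<open>Maximality of an orthonormal basis\<close>

lemma orthonormal_basis_complete:
  assumes "orthonormal_basis ip S" and orth: "\<And>s. s \<in> S \<Longrightarrow> ip y s = 0"
  shows "y = 0"
proof (rule ccontr)
  assume "y \<noteq> 0"
  hence h: "hnorm ip y \<noteq> 0"
    using ip_self [of y] ip_eq_0_iff [of y] by auto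
  \<comment> \<open>Real rescaling preserves orthogonality to \<open>S\<close>, and since
    \<open>ip y y\<close> is real it yields a unit vector that could be adjoined to
    \<open>S\<close>.\<close>
  define e where "e = inverse (hnorm ip y) *\<^sub>R y"
  have e: "ip e e = 1"
    using h by (simp add: e_def ip_bilinear ip_self [of y] power2_eq_square field_simps)
  have es: "ip e s = 0" "ip s e = 0" if "s \<in> S" for s
    using orth [OF that] ip_cnj [of s e] by (simp_all add: e_def ip_bilinear)
  have "(1 :: octonion) \<noteq> 0" by (simp add: octonion_defs)
  with e es have "e \<notin> S" by metis
  moreover have "orthonormal_system ip (insert e S)"
    using assms(1) e es by (auto simp: orthonormal_basis_def orthonormal_system_def)
  ultimately show False
    using assms(1) by (auto simp: orthonormal_basis_def)
qed

section \<open>Partial Fourier sums\<close>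

definition fourier_sum :: "'h \<Rightarrow> 'h set \<Rightarrow> 'h" where
  "fourier_sum x F = (\<Sum>s\<in>F. L (ip x s) s)"

lemma Re_ip_fourier_sum:
  "oct_Re (ip (fourier_sum x F) v) = (\<Sum>s\<in>F. inner (ip x s) (ip v s))"
proof -
  have "linear (\<lambda>u. oct_Re (ip u v))"
    by (rule linearI) (simp_all add: ip_bilinear)
  from linear_sum [OF this, of "\<lambda>s. L (ip x s) s" F] show ?thesis
    by (simp add: fourier_sum_def Re_ip_L)
qed

text \<open>Weak associativity enters here: it pulls the coefficient out of
  \<open>ip (L p t) s\<close>, leaving \<open>p * ip t s\<close>.\<close>

lemma ip_fourier_sum:
  assumes "weak_associative L ip S" "finite F" "F \<subseteq> S" "s \<in> S"
  shows "ip (fourier_sum x F) s = (if s \<in> F then ip x s else 0)"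
proof -
  have *: "ip (L p t) s = (if t = s then p else 0)" if "t \<in> F" for p t
  proof -
    have t: "t \<in> S" using assms(3) that by blast
    have "second_associator L ip p t s = 0"
      using assms(1,4) t by (simp add: weak_associative_def)
    moreover have "ip t s = (if t = s then 1 else 0)"
      using assms(1,4) t
      by (simp add: weak_associative_def orthonormal_basis_def orthonormal_system_def)
    ultimately show ?thesis
      by (simp add: second_associator_def octonion_mult_1 split: if_splits)
  qed
  have "ip (fourier_sum x F) s = (\<Sum>t\<in>F. ip (L (ip x t) t) s)"
    by (simp add: fourier_sum_def linear_sum [OF linear_ip_left])
  also have "\<dots> = (\<Sum>t\<in>F. if t = s then ip x t else 0)"
    by (rule sum.cong) (simp_all add: *)
  finally show ?thesis
    using assms(2) by (simp add: sum.delta)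
qed

lemma Re_ip_fourier_sums:
  assumes "weak_associative L ip S" "finite F" "F \<subseteq> S" "finite G" "G \<subseteq> S"
  shows "oct_Re (ip (fourier_sum x F) (fourier_sum x G)) = (\<Sum>s\<in>F \<inter> G. (norm (ip x s))\<^sup>2)"
proof -
  have "oct_Re (ip (fourier_sum x F) (fourier_sum x G)) =
      (\<Sum>s\<in>F. if s \<in> G then (norm (ip x s))\<^sup>2 else 0)"
    unfolding Re_ip_fourier_sum
  proof (rule sum.cong)
    fix s assume "s \<in> F"
    with assms(3) have "s \<in> S" by blast
    thus "inner (ip x s) (ip (fourier_sum x G) s) = (if s \<in> G then (norm (ip x s))\<^sup>2 else 0)"
      by (simp add: ip_fourier_sum [OF assms(1,4,5)] power2_norm_eq_inner)
  qed simp
  thus ?thesis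
    using assms(2) by (simp add: sum.inter_restrict)
qed

lemma hnorm_fourier_sum_sq:
  assumes "weak_associative L ip S" "finite F" "F \<subseteq> S"
  shows "(hnorm ip (fourier_sum x F))\<^sup>2 = (\<Sum>s\<in>F. (norm (ip x s))\<^sup>2)"
  using Re_ip_fourier_sums [OF assms assms(2,3), of x] by (simp add: hnorm_sq)

text \<open>Pythagoras for the remainder. It yields Bessel's inequality at once and Parseval's
  identity in the limit.\<close>

lemma hnorm_fourier_sum_remainder_sq:
  assumes "weak_associative L ip S" "finite F" "F \<subseteq> S"
  shows "(hnorm ip (x - fourier_sum x F))\<^sup>2 = (hnorm ip x)\<^sup>2 - (\<Sum>s\<in>F. (norm (ip x s))\<^sup>2)"
  by (simp add: hnorm_diff_sq hnorm_fourier_sum_sq [OF assms] Re_ip_fourier_sum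
      power2_norm_eq_inner)

text \<open>The right-hand side is the sum of \<open>a\<close> over the symmetric difference,
  written so that an upper bound on \<open>sum a (F \<union> G)\<close> gives the Cauchy
  estimate.\<close>

lemma hnorm_fourier_sums_diff_sq:
  fixes x :: 'h
  assumes "weak_associative L ip S" "finite F" "F \<subseteq> S" "finite G" "G \<subseteq> S"
  defines "a \<equiv> \<lambda>s. (norm (ip x s))\<^sup>2"
  shows "(hnorm ip (fourier_sum x F - fourier_sum x G))\<^sup>2 = 2 * sum a (F \<union> G) - sum a F - sum a G"
proof -
  have "(hnorm ip (fourier_sum x F - fourier_sum x G))\<^sup>2 = sum a F - 2 * sum a (G \<inter> F) + sum a G"
    unfolding hnorm_diff_sq
    by (simp add: a_def hnorm_fourier_sum_sq [OF assms(1-3)] hnorm_fourier_sum_sq [OF assms(1,4,5)]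
        Re_ip_fourier_sums [OF assms(1,4,5,2,3)])
  moreover have "sum a (F \<union> G) + sum a (G \<inter> F) = sum a F + sum a G"
    using sum.union_inter [OF assms(2,4), of a] by (simp add: Int_commute)
  ultimately show ?thesis by linarith
qed

lemma hnorm_minus_commute: "hnorm ip (u - v) = hnorm ip (v - u)"
  by (simp add: hnorm_def ip_bilinear)

section \<open>From weak associativity to Parseval's identity\<close>

lemma weak_associative_parseval:
  assumes wa: "weak_associative L ip S"
  shows "((\<lambda>s. (norm (ip x s))\<^sup>2) has_sum (hnorm ip x)\<^sup>2) S"
proof -
  define a where "a = (\<lambda>s. (norm (ip x s))\<^sup>2)"
  have bessel: "sum a F \<le> (hnorm ip x)\<^sup>2" if "finite F" "F \<subseteq> S" for F
    using hnorm_fourier_sum_remainder_sq [OF wa that, of x]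
      zero_le_power2 [of "hnorm ip (x - fourier_sum x F)"]
    unfolding a_def by linarith
  have summable: "a summable_on S"
    by (rule nonneg_bdd_above_summable_on)
      (auto simp: a_def intro!: bdd_aboveI2 bessel [unfolded a_def])
  define A where "A = infsum a S"
  have A: "(a has_sum A) S"
    using summable by (simp add: A_def)
  have le_A: "sum a F \<le> A" if "finite F" "F \<subseteq> S" for F
    unfolding A_def by (rule finite_sum_le_infsum [OF summable that]) (simp add: a_def)
  \<comment> \<open>Completeness is stated for sequences while \<open>S\<close> may be uncountable,
    so a sequence of finite sets with sums tending to \<open>A\<close> is extracted. These sets need
    neither increase nor exhaust \<open>S\<close>.\<close>
  have "\<exists>F. finite F \<and> F \<subseteq> S \<and> A - sum a F < 1 / real (Suc n)" for n
  proof -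
    have "eventually (\<lambda>F. dist (sum a F) A < 1 / real (Suc n)) (finite_subsets_at_top S)"
      using A unfolding has_sum_def by (rule tendstoD) simp
    then obtain F where F: "finite F" "F \<subseteq> S" "dist (sum a F) A < 1 / real (Suc n)"
      unfolding eventually_finite_subsets_at_top by blast
    thus ?thesis by (intro exI [of _ F]) (simp add: dist_real_def)
  qed
  then obtain F where F: "\<And>n. finite (F n)" "\<And>n. F n \<subseteq> S"
      "\<And>n. A - sum a (F n) < 1 / real (Suc n)"
    by metis
  define d where "d = (\<lambda>n. A - sum a (F n))"
  have d_nonneg: "d n \<ge> 0" for n
    using le_A F by (simp add: d_def)
  have d: "d \<longlonglongrightarrow> 0"
    by (rule tendsto_sandwich [OF _ _ tendsto_const LIMSEQ_inverse_real_of_nat])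
      (use d_nonneg F(3) in \<open>auto simp: d_def inverse_eq_divide intro!: always_eventually less_imp_le\<close>)
  define X where "X = (\<lambda>n. fourier_sum x (F n))"
  \<comment> \<open>Bounding the sum over the union by \<open>A\<close> leaves exactly the two
    deficits \<open>d m\<close> and \<open>d n\<close>.\<close>
  have X_diff: "(hnorm ip (X m - X n))\<^sup>2 \<le> d m + d n" for m n
    using le_A [of "F m \<union> F n"] F(1,2)
    by (simp add: X_def d_def a_def hnorm_fourier_sums_diff_sq [OF wa])
  have "\<forall>e>0. \<exists>N. \<forall>m\<ge>N. \<forall>n\<ge>N. hnorm ip (X m - X n) < e"
  proof (intro allI impI)
    fix e :: real assume e: "e > 0"
    hence "eventually (\<lambda>n. d n < e\<^sup>2 / 2) sequentially"
      by (intro order_tendstoD [OF d]) simp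
    then obtain N where N: "\<And>n. n \<ge> N \<Longrightarrow> d n < e\<^sup>2 / 2"
      by (auto simp: eventually_sequentially)
    show "\<exists>N. \<forall>m\<ge>N. \<forall>n\<ge>N. hnorm ip (X m - X n) < e"
    proof (intro exI [of _ N] allI impI)
      fix m n assume "m \<ge> N" "n \<ge> N"
      hence "(hnorm ip (X m - X n))\<^sup>2 < e\<^sup>2"
        using N [of m] N [of n] X_diff [of m n] by linarith
      thus "hnorm ip (X m - X n) < e"
        using e by (simp add: power2_less_imp_less)
    qed
  qed
  then obtain l where l: "(\<lambda>n. hnorm ip (X n - l)) \<longlonglongrightarrow> 0"
    using complete by blast
  have "ip (x - l) s = 0" if s: "s \<in> S" for s
  proof -
    have unit: "ip s s = 1"
      using wa s by (simp add: weak_associative_def orthonormal_basis_def orthonormal_system_def)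
    \<comment> \<open>If \<open>s\<close> lies in \<open>F n\<close>, its coefficient cancels
      exactly. Otherwise its squared modulus is part of the mass \<open>d n\<close> that
      \<open>F n\<close> misses.\<close>
    have near: "norm (ip (x - X n) s) \<le> sqrt (d n)" for n
    proof (cases "s \<in> F n")
      case True
      thus ?thesis
        using d_nonneg [of n] by (simp add: X_def ip_bilinear ip_fourier_sum [OF wa F(1,2) s])
    next
      case False
      have "a s + sum a (F n) \<le> A"
        using le_A [of "insert s (F n)"] F s False by simp
      with False show ?thesis
        by (intro real_le_rsqrt) (simp add: X_def ip_bilinear ip_fourier_sum [OF wa F(1,2) s] d_def a_def)
    qed
    have "norm (ip (x - l) s) \<le> sqrt (d n) + hnorm ip (X n - l)" for n
    proof -
      have "ip (x - l) s = ip (x - X n) s + ip (X n - l) s"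
        by (simp add: ip_bilinear)
      thus ?thesis
        using norm_triangle_ineq [of "ip (x - X n) s" "ip (X n - l) s"]
          near [of n] ip_unit_bound [OF unit, of "X n - l"] by simp
    qed
    moreover have "(\<lambda>n. sqrt (d n) + hnorm ip (X n - l)) \<longlonglongrightarrow> 0"
      using tendsto_add [OF tendsto_real_sqrt [OF d] l] by simp
    ultimately have "norm (ip (x - l) s) \<le> 0"
      by (intro LIMSEQ_le_const) auto
    thus ?thesis by simp
  qed
  hence "x - l = 0"
    using wa by (intro orthonormal_basis_complete [of S]) (auto simp: weak_associative_def)
  with l have "(\<lambda>n. (hnorm ip (X n - x))\<^sup>2) \<longlonglongrightarrow> 0"
    using tendsto_power [of _ "0 :: real" sequentially 2] by force
  \<comment> \<open>By the remainder formula this sequence also tends to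
    \<open>(hnorm ip x)\<^sup>2 - A\<close>; comparing it with the limit 0 identifies
    \<open>A\<close>.\<close>
  moreover have "(hnorm ip (X n - x))\<^sup>2 = (hnorm ip x)\<^sup>2 - A + d n" for n
    using hnorm_fourier_sum_remainder_sq [OF wa F(1,2), of x n]
    by (simp add: X_def d_def a_def hnorm_minus_commute [of _ x])
  ultimately have "(\<lambda>n. (hnorm ip x)\<^sup>2 - A + d n) \<longlonglongrightarrow> 0"
    by simp
  moreover have "(\<lambda>n. (hnorm ip x)\<^sup>2 - A + d n) \<longlonglongrightarrow> (hnorm ip x)\<^sup>2 - A"
    using tendsto_add [OF tendsto_const d] by simp
  ultimately have "(hnorm ip x)\<^sup>2 - A = 0"
    using LIMSEQ_unique by blast
  with A show ?thesis by (simp add: a_def)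
qed

end

theorem theorem4p12:
  fixes L :: "octonion \<Rightarrow> 'h \<Rightarrow> 'h::real_vector"
    and ip :: "'h \<Rightarrow> 'h \<Rightarrow> octonion"
    and S :: "'h set"
  assumes "hilbert_left_octonion_module L ip"
    and "orthonormal_basis ip S"
  shows "hilbert_basis ip S \<longleftrightarrow> weak_associative L ip S"
proof -
  interpret hilbert_left_octonion_module L ip by (rule assms(1))
  show ?thesis
    using hilbert_basis_imp_weak_associative weak_associative_parseval assms(2)
    by (auto simp: hilbert_basis_def)
qed

end
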